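(* Let $\Lambda>0$, $\eta>0$, $N\ge1$, $\ell=\Lambda/N$, $H_0\equiv\frac12I$. For $z=x+i\eta$ with $x\in\mathbb{R}$ and a block perturbation $\Delta q=(\Delta q_0,\dots,\Delta q_{N-1})\in\mathbb{C}^N$, $$Dv_{H_0,\Lambda}(z)[\Delta q]=-2i\sin\!\Big(\frac{z\ell}{2}\Big)\sum_{j=0}^{N-1}\Delta q_j\,e^{iz(j+\frac12)\ell}.$$ Hence, for sample points $z_k=x_k+i\eta$, $x=(x_1,\dots,x_M)\in\mathbb{R}^M$, the free Jacobian $T_x:\mathbb{C}^N\to\mathbb{C}^M$, $(T_x\Delta q)_k=Dv_{H_0,\Lambda}(z_k)[\Delta q]$, satisfies $$(T_x\Delta q)_k=\gamma_k(x_k)\sum_{j=0}^{N-1}\Delta q_j\,e^{ix_kj\ell}w_j,$$ where $\gamma_k(x_k)=-2i\sin\!\big(\frac{(x_k+i\eta)\ell}{2}\big)e^{ix_k\ell/2}$ and $w_j=e^{-\eta(j+\frac12)\ell}$. Equivalently, $T_x=D_\gamma(x)F_xD_w$ with $(F_x)_{kj}=e^{ix_kj\ell}$, $D_\gamma(x)=\operatorname{diag}(\gamma_1(x_1),\dots,\gamma_M(x_M))$, $D_w=\operatorname{diag}(w_0,\dots,w_{N-1})$.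
   Context: Let $J=\begin{pmatrix}0&-1\\1&0\end{pmatrix}$. A trace-normed Hamiltonian on $[0,\Lambda]$ is a measurable $H:[0,\Lambda]\to\mathbb{R}^{2\times2}$ with $H(s)$ symmetric, $H(s)\succeq0$ and $\operatorname{tr}H(s)=1$ for a.e. $s$; it is extended to $[0,\infty)$ by the free tail $H(s)=\frac12I$ for $s\ge\Lambda$. For $\operatorname{Im}z>0$, the Weyl coefficient $m_{H,\Lambda}(z)$ is the unique $m\in\mathbb{C}$ such that the solution of $JY'(s)=zH(s)Y(s)$ on $[0,\infty)$ with $Y(0)=(1,m)^\top$ is square-integrable, i.e. $\int_0^\infty Y^*HY\,ds<\infty$; it satisfies $\operatorname{Im}m_{H,\Lambda}(z)>0$. Its Schur transform is $v_{H,\Lambda}(z)=\dfrac{m_{H,\Lambda}(z)-i}{m_{H,\Lambda}(z)+i}$. For $q\in\mathbb{C}$, $X_q:=\begin{pmatrix}\operatorname{Re}q&\operatorname{Im}q\\ \operatorname{Im}q&-\operatorname{Re}q\end{pmatrix}$. For a bounded function $q$ on $[0,\Lambda]$, $Dv_{H_0,\Lambda}(z)[q]$ is the derivative at $\tau=0$ (real $\tau$) of $\tau\mapsto v_{H_0+\tau X_q,\Lambda}(z)$. With $I_j=[j\ell,(j+1)\ell)$, a block perturbation $\Delta q\in\mathbb{C}^N$ is identified with the function $\sum_{j=0}^{N-1}\Delta q_j\mathbf{1}_{I_j}$. *)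

theory Defs
  imports "HOL-Analysis.Analysis" "Jordan_Normal_Form.Matrix"
begin

text \<open>
  Both imports provide matrices.  The \<open>2 \<times> 2\<close> Hamiltonians and the solutions of the canonical
  system live in the Euclidean types \<open>real^2^2\<close> and \<open>complex^2\<close> of HOL-Analysis, where the
  integration theory is available; the objects of variable size (sample points, block
  perturbations, the Jacobian and its factors) are vectors and matrices of Jordan_Normal_Form.
\<close>

unbundle no vec_syntax

abbreviation ent :: "'a ^ 'n \<Rightarrow> 'n \<Rightarrow> 'a"
  where "ent \<equiv> Finite_Cartesian_Product.vec_nth"


subsection \<open>Hamiltonians\<close>

definition Jmat :: "complex^2^2"
  where "Jmat = vector [vector [0, -1], vector [1, 0]]"

definition trace_normed_hamiltonian :: "real \<Rightarrow> (real \<Rightarrow> real^2^2) \<Rightarrow> bool"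
  where "trace_normed_hamiltonian \<Lambda> H \<longleftrightarrow>
    H \<in> borel_measurable (lebesgue_on {0..\<Lambda>}) \<and>
    (AE s in lebesgue_on {0..\<Lambda>}.
       Finite_Cartesian_Product.transpose (H s) = H s \<and>
       (\<forall>v. 0 \<le> inner v (H s *v v)) \<and>
       Determinants.trace (H s) = 1)"

definition free_hamiltonian :: "real \<Rightarrow> real^2^2"
  where "free_hamiltonian s = Finite_Cartesian_Product.mat (1/2)"

definition extend_free :: "real \<Rightarrow> (real \<Rightarrow> real^2^2) \<Rightarrow> real \<Rightarrow> real^2^2"
  where "extend_free \<Lambda> H s = (if s < \<Lambda> then H s else free_hamiltonian s)"


subsection \<open>The canonical system and the Weyl coefficient\<close>

definition cmat :: "real^2^2 \<Rightarrow> complex^2^2"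
  where "cmat = map_matrix complex_of_real"

text \<open>
  As \<open>H\<close> is merely measurable, solutions are locally absolutely continuous functions satisfying
  the equation almost everywhere.  Local absolute continuity of \<open>Y\<close> on the half line is expressed
  by an almost-everywhere derivative \<open>Y'\<close> that is locally Lebesgue integrable and has \<open>Y\<close> as an
  indefinite integral.
\<close>

definition canonical_solution :: "complex \<Rightarrow> (real \<Rightarrow> real^2^2) \<Rightarrow> (real \<Rightarrow> complex^2) \<Rightarrow> bool"
  where "canonical_solution z H Y \<longleftrightarrow>
    (\<exists>Y'. (\<forall>s\<ge>0. Y' absolutely_integrable_on {0..s} \<and> Y s = Y 0 + integral {0..s} Y') \<and>
          (AE s in lebesgue_on {0..}. Jmat *v Y' s = z *s (cmat (H s) *v Y s)))"

definition energy_density :: "(real \<Rightarrow> real^2^2) \<Rightarrow> (real \<Rightarrow> complex^2) \<Rightarrow> real \<Rightarrow> complex"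
  where "energy_density H Y s = (\<Sum>i\<in>UNIV. cnj (ent (Y s) i) * ent (cmat (H s) *v Y s) i)"

definition weyl :: "real \<Rightarrow> (real \<Rightarrow> real^2^2) \<Rightarrow> complex \<Rightarrow> complex"
  where "weyl \<Lambda> H z = (THE m. \<exists>Y.
    canonical_solution z (extend_free \<Lambda> H) Y \<and> Y 0 = vector [1, m] \<and>
    energy_density (extend_free \<Lambda> H) Y absolutely_integrable_on {0..})"

definition schur :: "real \<Rightarrow> (real \<Rightarrow> real^2^2) \<Rightarrow> complex \<Rightarrow> complex"
  where "schur \<Lambda> H z = (weyl \<Lambda> H z - \<i>) / (weyl \<Lambda> H z + \<i>)"


subsection \<open>Perturbations\<close>

definition Xmat :: "complex \<Rightarrow> real^2^2"
  where "Xmat q = vector [vector [Re q, Im q], vector [Im q, - Re q]]"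

definition perturb :: "(real \<Rightarrow> real^2^2) \<Rightarrow> (real \<Rightarrow> complex) \<Rightarrow> real \<Rightarrow> real \<Rightarrow> real^2^2"
  where "perturb H q \<tau> s = H s + \<tau> *\<^sub>R Xmat (q s)"

definition Dv :: "real \<Rightarrow> (real \<Rightarrow> real^2^2) \<Rightarrow> complex \<Rightarrow> (real \<Rightarrow> complex) \<Rightarrow> complex"
  where "Dv \<Lambda> H z q = vector_derivative (\<lambda>\<tau>. schur \<Lambda> (perturb H q \<tau>) z) (at 0)"

definition block_fun :: "real \<Rightarrow> complex vec \<Rightarrow> real \<Rightarrow> complex"
  where "block_fun l dq s =
    (\<Sum>j<dim_vec dq. dq $ j * indicator {real j * l..<real (j + 1) * l} s)"

text \<open>
  Around the free Hamiltonian the path \<open>\<tau> \<mapsto> perturb free_hamiltonian q \<tau>\<close> stays among the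
  trace-normed Hamiltonians for small \<open>\<tau>\<close>, so \<open>Dv\<close> only sees Weyl coefficients of such.
\<close>

lemma Xmat_decomp:
  "Xmat q = Re q *\<^sub>R vector [vector [1, 0], vector [0, -1]] + Im q *\<^sub>R vector [vector [0, 1], vector [1, 0]]"
  by (auto simp: Xmat_def Finite_Cartesian_Product.vec_eq_iff forall_2)

lemma trace_normed_perturb_free:
  assumes meas: "q \<in> borel_measurable (lebesgue_on {0..\<Lambda>})"
    and bnd: "\<And>s. s \<in> {0..\<Lambda>} \<Longrightarrow> cmod (q s) \<le> B" and \<tau>: "\<bar>\<tau>\<bar> * B \<le> 1/2"
  shows "trace_normed_hamiltonian \<Lambda> (perturb free_hamiltonian q \<tau>)"
proof -
  have "(\<lambda>s. perturb free_hamiltonian q \<tau> s) \<in> borel_measurable (lebesgue_on {0..\<Lambda>})"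
    unfolding perturb_def free_hamiltonian_def Xmat_decomp
    using borel_measurable_Re borel_measurable_Im meas by (auto intro!: measurable_compose[OF meas])
  moreover have "Finite_Cartesian_Product.transpose (perturb free_hamiltonian q \<tau> s)
      = perturb free_hamiltonian q \<tau> s \<and>
      Determinants.trace (perturb free_hamiltonian q \<tau> s) = 1" for s
    by (auto simp: perturb_def free_hamiltonian_def Xmat_def Finite_Cartesian_Product.vec_eq_iff forall_2 sum_2
        Finite_Cartesian_Product.transpose_def Determinants.trace_def Finite_Cartesian_Product.mat_def)
  moreover have "0 \<le> inner v (perturb free_hamiltonian q \<tau> s *v v)" if "s \<in> {0..\<Lambda>}" for s v
  proof -
    define a b x y where "a = Re (q s)" and "b = Im (q s)" and "x = ent v 1" and "y = ent v 2"
    have eq: "inner v (perturb free_hamiltonian q \<tau> s *v v)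
        = (x\<^sup>2 + y\<^sup>2)/2 + \<tau> * (a * (x\<^sup>2 - y\<^sup>2) + b * (2*x*y))"
      by (simp add: perturb_def free_hamiltonian_def Xmat_def inner_vec_def sum_2
          Finite_Cartesian_Product.mat_def matrix_vector_mult_def a_def b_def x_def y_def
          algebra_simps power2_eq_square)
    have "(a * (x\<^sup>2 - y\<^sup>2) + b * (2*x*y))\<^sup>2 + (a * (2*x*y) - b * (x\<^sup>2 - y\<^sup>2))\<^sup>2
        = (a\<^sup>2 + b\<^sup>2) * (x\<^sup>2 + y\<^sup>2)\<^sup>2"
      by (simp add: power2_eq_square algebra_simps)
    then have "(a * (x\<^sup>2 - y\<^sup>2) + b * (2*x*y))\<^sup>2 \<le> (cmod (q s) * (x\<^sup>2 + y\<^sup>2))\<^sup>2"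
      by (simp add: power_mult_distrib cmod_power2 a_def b_def) (smt (verit) zero_le_power2)
    then have "\<bar>a * (x\<^sup>2 - y\<^sup>2) + b * (2*x*y)\<bar> \<le> cmod (q s) * (x\<^sup>2 + y\<^sup>2)"
      by (rule abs_le_square_iff[THEN iffD2, THEN order_trans]) simp
    then have "\<bar>\<tau> * (a * (x\<^sup>2 - y\<^sup>2) + b * (2*x*y))\<bar> \<le> \<bar>\<tau>\<bar> * (cmod (q s) * (x\<^sup>2 + y\<^sup>2))"
      by (simp add: abs_mult mult_left_mono)
    also have "\<dots> \<le> \<bar>\<tau>\<bar> * (B * (x\<^sup>2 + y\<^sup>2))"
      using bnd[OF that] by (intro mult_left_mono mult_right_mono) auto
    also have "\<dots> \<le> 1/2 * (x\<^sup>2 + y\<^sup>2)"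
      using mult_right_mono[OF \<tau>, of "x\<^sup>2 + y\<^sup>2"] by (simp add: mult.assoc)
    finally show ?thesis unfolding eq by linarith
  qed
  ultimately show ?thesis
    unfolding trace_normed_hamiltonian_def
    by (auto intro!: AE_I2)
qed


subsection \<open>The free Jacobian and its factors\<close>

definition free_jacobian :: "real \<Rightarrow> real \<Rightarrow> nat \<Rightarrow> real vec \<Rightarrow> complex vec \<Rightarrow> complex vec"
  where "free_jacobian \<Lambda> \<eta> N x dq =
    vec (dim_vec x) (\<lambda>k. Dv \<Lambda> free_hamiltonian (Complex (x $ k) \<eta>) (block_fun (\<Lambda> / real N) dq))"

definition gam :: "real \<Rightarrow> real \<Rightarrow> real \<Rightarrow> complex"
  where "gam \<eta> l x =
    - 2 * \<i> * sin (Complex x \<eta> * of_real l / 2) * exp (\<i> * of_real x * of_real l / 2)"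

definition wgt :: "real \<Rightarrow> real \<Rightarrow> nat \<Rightarrow> real"
  where "wgt \<eta> l j = exp (- \<eta> * (real j + 1/2) * l)"

definition Fmat :: "real \<Rightarrow> nat \<Rightarrow> real vec \<Rightarrow> complex mat"
  where "Fmat l N x =
    Matrix.mat (dim_vec x) N (\<lambda>(k, j). exp (\<i> * of_real (x $ k) * of_nat j * of_real l))"

definition Dgam :: "real \<Rightarrow> real \<Rightarrow> real vec \<Rightarrow> complex mat"
  where "Dgam \<eta> l x = mat_diag (dim_vec x) (\<lambda>k. gam \<eta> l (x $ k))"

definition Dwgt :: "real \<Rightarrow> real \<Rightarrow> nat \<Rightarrow> complex mat"
  where "Dwgt \<eta> l N = mat_diag N (\<lambda>j. of_real (wgt \<eta> l j))"

end

theory Submission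
  imports Defs
begin

text \<open>
  In the coordinates \<open>u = Y\<^sub>1 + i Y\<^sub>2\<close>, \<open>w = Y\<^sub>1 - i Y\<^sub>2\<close> the canonical system with Hamiltonian
  \<open>I/2 + X\<^sub>p\<close> reads \<open>u' = -iz(u/2 + p w)\<close>, \<open>w' = iz(w/2 + cnj p u)\<close>, and the Schur transform of the
  Weyl coefficient is \<open>-u(0)/w(0)\<close> for the solution with \<open>u = 0\<close> on the free tail.  For a
  piecewise constant \<open>p = \<tau> q\<close> this solution is a product of explicit matrix exponentials, which
  is smooth in \<open>\<tau>\<close> near 0.  As \<open>u = 0\<close> at \<open>\<tau> = 0\<close>, only the derivative of \<open>u\<close> contributes, and
  it obeys an affine recursion over the blocks whose solution is the claimed exponential sum.
\<close>

section \<open>Block solutions in rotated coordinates\<close>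

text \<open>For piecewise continuous \<open>p\<close> an absolutely continuous solution is classical
  away from the jumps. \<open>S\<close> is meant to contain these jumps; continuity up to
  \<open>a\<close> glues the pieces together, and \<open>a\<close> itself is exempt because the
  derivatives are two-sided.\<close>

definition rotated_system ::
    "complex \<Rightarrow> (real \<Rightarrow> complex) \<Rightarrow> real set \<Rightarrow> real \<Rightarrow> (real \<Rightarrow> complex) \<Rightarrow> (real \<Rightarrow> complex) \<Rightarrow> bool"
  where "rotated_system z p S a u w \<longleftrightarrow>
    continuous_on {a..} u \<and> continuous_on {a..} w \<and>
    (\<forall>s. a < s \<and> s \<notin> S \<longrightarrow>
      (u has_vector_derivative - (\<i> * z * (u s / 2 + p s * w s))) (at s) \<and>
      (w has_vector_derivative \<i> * z * (w s / 2 + cnj (p s) * u s)) (at s))"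

lemma rotated_system_scale:
  assumes "rotated_system z p S a u w"
  shows "rotated_system z p S a (\<lambda>s. c * u s) (\<lambda>s. c * w s)"
  unfolding rotated_system_def
proof (intro conjI allI impI)
  show "continuous_on {a..} (\<lambda>s. c * u s)" "continuous_on {a..} (\<lambda>s. c * w s)"
    using assms by (auto simp: rotated_system_def intro!: continuous_intros)
next
  fix s assume s: "a < s \<and> s \<notin> S"
  have "(u has_vector_derivative - (\<i> * z * (u s / 2 + p s * w s))) (at s)"
    "(w has_vector_derivative \<i> * z * (w s / 2 + cnj (p s) * u s)) (at s)"
    using assms s by (auto simp: rotated_system_def)
  then show "((\<lambda>s. c * u s) has_vector_derivative - (\<i> * z * (c * u s / 2 + p s * (c * w s)))) (at s)"
    "((\<lambda>s. c * w s) has_vector_derivative \<i> * z * (c * w s / 2 + cnj (p s) * (c * u s))) (at s)"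
    by (auto intro!: derivative_eq_intros simp: algebra_simps)
qed

text \<open>The coefficient matrix has diagonal entries \<open>-iz/2\<close> and
  \<open>iz/2\<close>, hence trace 0, so the determinant of two solutions has derivative 0. A
  continuous function tolerates the finitely many exceptional points.\<close>

lemma rotated_system_wronskian:
  assumes 1: "rotated_system z p S a u1 w1" and 2: "rotated_system z p S a u2 w2"
    and "finite S" and "a \<le> s"
  shows "u1 s * w2 s - w1 s * u2 s = u1 a * w2 a - w1 a * u2 a"
proof (rule has_derivative_zero_unique_strong_interval[of "insert a S" a s])
  show "finite (insert a S)" using \<open>finite S\<close> by simp
  show "continuous_on {a..s} (\<lambda>s. u1 s * w2 s - w1 s * u2 s)"
    using 1 2 unfolding rotated_system_def
    by (auto intro!: continuous_intros elim!: continuous_on_subset)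
next
  fix t assume "t \<in> {a..s} - insert a S"
  then have t: "a < t" "t \<notin> S" by auto
  have "((\<lambda>s. u1 s * w2 s - w1 s * u2 s) has_vector_derivative 0) (at t)"
    using 1 2 t unfolding rotated_system_def
    by (auto intro!: derivative_eq_intros simp: algebra_simps)
  then show "((\<lambda>s. u1 s * w2 s - w1 s * u2 s) has_derivative (\<lambda>h. 0)) (at t within {a..s})"
    by (simp add: has_vector_derivative_def has_derivative_at_withinI)
qed (use \<open>a \<le> s\<close> in auto)

text \<open>
  Propagation to the left across a block of length \<open>t\<close> with constant \<open>p = c\<close>: the coefficient
  matrix squares to \<open>(1/4 - |c|\<^sup>2) I = \<mu>\<^sup>2 I\<close> up to the factor \<open>(iz)\<^sup>2\<close>, so its exponential has the
  closed form below.  It is meaningful only for \<open>|c| < 1/2\<close>: for \<open>|c| = 1/2\<close> the division by \<open>\<mu>\<close>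
  is a division by 0, and for \<open>|c| > 1/2\<close> the real square root is negative.
\<close>

definition block_transfer :: "complex \<Rightarrow> real \<Rightarrow> complex \<Rightarrow> complex \<times> complex \<Rightarrow> complex \<times> complex"
  where "block_transfer z t c v =
    (let \<mu> = complex_of_real (sqrt (1/4 - (cmod c)\<^sup>2));
         C = cos (z * \<mu> * of_real t); \<sigma> = sin (z * \<mu> * of_real t) / \<mu>
     in ((C + \<i> * \<sigma> / 2) * fst v + \<i> * \<sigma> * c * snd v,
         (C - \<i> * \<sigma> / 2) * snd v - \<i> * \<sigma> * cnj c * fst v))"

lemma block_transfer_0 [simp]: "block_transfer z 0 c v = v"
  by (simp add: block_transfer_def Let_def)

lemma block_transfer_derivative:
  fixes b s :: real and z c :: complex and v :: "complex \<times> complex"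
  assumes c: "cmod c < 1/2"
  defines "f \<equiv> \<lambda>s. block_transfer z (b - s) c v"
  shows "((\<lambda>s. fst (f s)) has_vector_derivative - (\<i> * z * (fst (f s) / 2 + c * snd (f s)))) (at s)"
    and "((\<lambda>s. snd (f s)) has_vector_derivative \<i> * z * (snd (f s) / 2 + cnj c * fst (f s))) (at s)"
proof -
  define \<mu> where "\<mu> = complex_of_real (sqrt (1/4 - (cmod c)\<^sup>2))"
  have less: "(cmod c)\<^sup>2 < 1/4"
    using power_strict_mono[OF c, of 2] by (simp add: power2_eq_square)
  have "\<mu>\<^sup>2 = of_real (1/4 - (cmod c)\<^sup>2)"
    using less unfolding \<mu>_def of_real_power[symmetric] by simp
  then have \<mu>2: "\<mu> * \<mu> = 1/4 - c * cnj c"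
    by (simp add: power2_eq_square complex_norm_square[symmetric])
  have "\<mu> \<noteq> 0" using less by (simp add: \<mu>_def)
  \<comment> \<open>These satisfy \<open>C' = z \<mu>^2 \<sigma>\<close> and
    \<open>\<sigma>' = -z C\<close>, where \<open>\<mu>\<close> enters only through its square.
    Substituting \<open>\<mu>2\<close> therefore reduces both claims to ring identities.\<close>
  define C \<sigma> where "C = (\<lambda>s. cos (z * \<mu> * of_real (b - s)))"
    and "\<sigma> = (\<lambda>s. sin (z * \<mu> * of_real (b - s)) / \<mu>)"
  have C: "(C has_vector_derivative z * (\<mu> * \<mu>) * \<sigma> s) (at s)"
  proof -
    \<comment> \<open>The derivative is taken in a complex variable and then restricted to the real
      axis.\<close>
    have "((\<lambda>\<zeta>. cos (z * \<mu> * (of_real b - \<zeta>))) has_field_derivative z * (\<mu> * \<mu>) * \<sigma> s) (at (of_real s))"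
      using \<open>\<mu> \<noteq> 0\<close> by (auto intro!: derivative_eq_intros simp: \<sigma>_def)
    from has_vector_derivative_real_field[OF this] show ?thesis by (simp add: C_def)
  qed
  have \<sigma>: "(\<sigma> has_vector_derivative - z * C s) (at s)"
  proof -
    have "((\<lambda>\<zeta>. sin (z * \<mu> * (of_real b - \<zeta>)) / \<mu>) has_field_derivative - z * C s) (at (of_real s))"
      using \<open>\<mu> \<noteq> 0\<close> by (auto intro!: derivative_eq_intros simp: C_def)
    from has_vector_derivative_real_field[OF this] show ?thesis by (simp add: \<sigma>_def)
  qed
  have f: "f = (\<lambda>s. ((C s + \<i> * \<sigma> s / 2) * fst v + \<i> * \<sigma> s * c * snd v,
         (C s - \<i> * \<sigma> s / 2) * snd v - \<i> * \<sigma> s * cnj c * fst v))"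
    by (simp add: f_def block_transfer_def Let_def \<mu>_def C_def \<sigma>_def)
  show "((\<lambda>s. fst (f s)) has_vector_derivative - (\<i> * z * (fst (f s) / 2 + c * snd (f s)))) (at s)"
    unfolding f fst_conv snd_conv
    by (rule derivative_eq_intros C \<sigma> refl)+ (simp add: \<mu>2 field_simps)
  show "((\<lambda>s. snd (f s)) has_vector_derivative \<i> * z * (snd (f s) / 2 + cnj c * fst (f s))) (at s)"
    unfolding f fst_conv snd_conv
    by (rule derivative_eq_intros C \<sigma> refl)+ (simp add: \<mu>2 field_simps)
qed

text \<open>The block solution is anchored at \<open>b\<close>, where it takes the values of the
  given one, so the glued functions stay continuous. The point \<open>b\<close> becomes exceptional
  because \<open>p\<close> may jump there.\<close>

lemma rotated_system_extend_left:
  assumes sys: "rotated_system z p S b u w" and "a < b"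
    and p: "\<And>s. a < s \<Longrightarrow> s < b \<Longrightarrow> p s = c" and c: "cmod c < 1/2"
  obtains u' w' where "rotated_system z p (insert b S) a u' w'"
    and "(u' a, w' a) = block_transfer z (b - a) c (u b, w b)"
    and "\<And>s. b \<le> s \<Longrightarrow> u' s = u s \<and> w' s = w s"
proof
  define f where "f = (\<lambda>s. block_transfer z (b - s) c (u b, w b))"
  have df: "((\<lambda>s. fst (f s)) has_vector_derivative - (\<i> * z * (fst (f s) / 2 + c * snd (f s)))) (at s)"
    "((\<lambda>s. snd (f s)) has_vector_derivative \<i> * z * (snd (f s) / 2 + cnj c * fst (f s))) (at s)" for s
    unfolding f_def by (rule block_transfer_derivative[OF c])+
  define u' where "u' = (\<lambda>s. if s \<le> b then fst (f s) else u s)"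
  define w' where "w' = (\<lambda>s. if s \<le> b then snd (f s) else w s)"
  have fb: "fst (f b) = u b" "snd (f b) = w b" by (simp_all add: f_def)
  have cf: "continuous_on {a..b} (\<lambda>s. fst (f s))" "continuous_on {a..b} (\<lambda>s. snd (f s))"
    using df by (meson continuous_at_imp_continuous_on has_vector_derivative_continuous)+
  have un: "{a..} = {a..b} \<union> {b..}" using \<open>a < b\<close> by auto
  show "rotated_system z p (insert b S) a u' w'"
    unfolding rotated_system_def
  proof (intro conjI allI impI)
    show "continuous_on {a..} u'"
      unfolding un u'_def using cf sys fb
      by (intro continuous_on_cases) (auto simp: rotated_system_def)
    show "continuous_on {a..} w'"
      unfolding un w'_def using cf sys fb
      by (intro continuous_on_cases) (auto simp: rotated_system_def)
  next
    fix s assume s: "a < s \<and> s \<notin> insert b S"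
    have "(u' has_vector_derivative - (\<i> * z * (u' s / 2 + p s * w' s))) (at s) \<and>
      (w' has_vector_derivative \<i> * z * (w' s / 2 + cnj (p s) * u' s)) (at s)"
    proof (cases "s < b")
      case True
      then show ?thesis
        using df[of s] s p[of s]
        by (auto simp: u'_def w'_def intro: has_vector_derivative_transform_within_open[of _ _ _ "{..<b}"])
    next
      case False
      with s have "b < s" by auto
      then show ?thesis
        using sys s unfolding rotated_system_def
        by (auto simp: u'_def w'_def intro: has_vector_derivative_transform_within_open[of _ _ _ "{b<..}"])
    qed
    then show "(u' has_vector_derivative - (\<i> * z * (u' s / 2 + p s * w' s))) (at s)"
      "(w' has_vector_derivative \<i> * z * (w' s / 2 + cnj (p s) * u' s)) (at s)" by auto
  qed
  show "(u' a, w' a) = block_transfer z (b - a) c (u b, w b)"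
    using \<open>a < b\<close> by (simp add: u'_def w'_def f_def)
  show "u' s = u s \<and> w' s = w s" if "b \<le> s" for s
    using that fb by (cases "s = b") (auto simp: u'_def w'_def)
qed

section \<open>Step functions and the solution that starts from the free tail\<close>

primrec blocks_transfer :: "complex \<Rightarrow> real \<Rightarrow> (nat \<Rightarrow> complex) \<Rightarrow> nat \<Rightarrow> complex \<times> complex"
  where "blocks_transfer z l q 0 = (0, 1)"
  | "blocks_transfer z l q (Suc n) = block_transfer z l (q 0) (blocks_transfer z l (q \<circ> Suc) n)"

text \<open>The left end \<open>a\<close> is a parameter so that an induction can strip off the
  leftmost block and continue from \<open>a + l\<close>; \<open>block_fun\<close> is the case
  \<open>a = 0\<close>.\<close>

definition step_fun :: "real \<Rightarrow> real \<Rightarrow> (nat \<Rightarrow> complex) \<Rightarrow> nat \<Rightarrow> real \<Rightarrow> complex"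
  where "step_fun a l q n s = (\<Sum>j<n. q j * indicator {a + real j * l..<a + real (j + 1) * l} s)"

lemma step_fun_Suc:
  "step_fun a l q (Suc n) s = q 0 * indicator {a..<a + l} s + step_fun (a + l) l (q \<circ> Suc) n s"
  unfolding step_fun_def by (subst sum.lessThan_Suc_shift) (simp add: algebra_simps)

lemma step_fun_left:
  assumes "0 < l" "s < a"
  shows "step_fun a l q n s = 0"
proof -
  have "s < a + real j * l" for j
    using assms by (meson add_increasing2 less_le_trans mult_nonneg_nonneg of_nat_0_le_iff less_imp_le order.strict_trans2 order_refl)
  then have "s \<notin> {a + real j * l..<a + real (j + 1) * l}" for j
    by (simp add: not_le)
  then show ?thesis by (simp add: step_fun_def)
qed

lemma step_fun_right:
  assumes "0 < l" "a + real n * l \<le> s"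
  shows "step_fun a l q n s = 0"
proof -
  have "a + real (j + 1) * l \<le> s" if "j < n" for j
  proof -
    have "real (j + 1) * l \<le> real n * l" using that \<open>0 < l\<close> by (intro mult_right_mono) auto
    then show ?thesis using assms by linarith
  qed
  then show ?thesis by (fastforce simp: step_fun_def indicator_def intro!: sum.neutral)
qed

lemma rotated_system_cong:
  assumes "\<And>s. a < s \<Longrightarrow> p s = p' s" "S \<subseteq> S'"
  shows "rotated_system z p S a u w \<Longrightarrow> rotated_system z p' S' a u w"
  using assms by (auto simp: rotated_system_def)

text \<open>Induction from the tail leftwards. Without blocks the solution is \<open>u = 0\<close>,
  \<open>w = exp(iz(s - a)/2)\<close>, which decays when \<open>Im z > 0\<close>; its value (0, 1)
  at the start of the tail is the base of \<open>blocks_transfer\<close>. Each step puts one block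
  in front.\<close>

lemma rotated_weyl_solution_exists:
  assumes "0 < l" and q: "\<And>j. j < n \<Longrightarrow> cmod (q j) < 1/2"
  obtains u w where
    "rotated_system z (step_fun a l q n) ((\<lambda>j. a + real j * l) ` {..n}) a u w"
    and "(u a, w a) = blocks_transfer z l q n"
    and "\<And>s. a + real n * l \<le> s \<Longrightarrow> u s = 0 \<and> w s = exp (\<i> * z * of_real (s - (a + real n * l)) / 2)"
  using q
proof (induction n arbitrary: a q thesis)
  case 0
  define w where "w = (\<lambda>s. exp (\<i> * z * complex_of_real (s - a) / 2))"
  have w: "(w has_vector_derivative \<i> * z * (w s / 2)) (at s)" for s
  proof -
    have "((\<lambda>\<zeta>. exp (\<i> * z * (\<zeta> - of_real a) / 2)) has_field_derivative \<i> * z * (w s / 2)) (at (of_real s))"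
      by (auto intro!: derivative_eq_intros simp: w_def)
    from has_vector_derivative_real_field[OF this] show ?thesis by (simp add: w_def)
  qed
  have "continuous_on {a..} w"
    using w by (meson continuous_at_imp_continuous_on has_vector_derivative_continuous)
  with w have "rotated_system z (step_fun a l q 0) ((\<lambda>j. a + real j * l) ` {..0}) a (\<lambda>_. 0) w"
    by (auto simp: rotated_system_def step_fun_def)
  then show ?case by (rule 0(1)) (auto simp: w_def)
next
  case (Suc n)
  let ?S = "(\<lambda>j. a + real j * l) ` {..Suc n}"
  obtain u w where sys: "rotated_system z (step_fun (a + l) l (q \<circ> Suc) n) ((\<lambda>j. a + l + real j * l) ` {..n}) (a + l) u w"
    and ini: "(u (a + l), w (a + l)) = blocks_transfer z l (q \<circ> Suc) n"
    and tail: "\<And>s. a + l + real n * l \<le> s \<Longrightarrow> u s = 0 \<and> w s = exp (\<i> * z * of_real (s - (a + l + real n * l)) / 2)"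
  proof (rule Suc.IH[of "a + l" "q \<circ> Suc"])
    show "cmod ((q \<circ> Suc) j) < 1/2" if "j < n" for j
      using Suc.prems(2)[of "Suc j"] that by simp
  qed blast
  have S: "(\<lambda>j. a + l + real j * l) ` {..n} \<subseteq> ?S"
  proof (rule image_subsetI)
    fix j assume "j \<in> {..n}"
    then show "a + l + real j * l \<in> ?S"
      by (intro image_eqI[of _ _ "Suc j"]) (auto simp: algebra_simps)
  qed
  \<comment> \<open>To the right of \<open>a + l\<close> the indicator of the first block vanishes,
    so the two step functions agree there.\<close>
  have "rotated_system z (step_fun a l q (Suc n)) ?S (a + l) u w"
    by (rule rotated_system_cong[OF _ S sys]) (simp add: step_fun_Suc)
  moreover have "step_fun a l q (Suc n) s = q 0" if "a < s" "s < a + l" for s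
    using that \<open>0 < l\<close> by (simp add: step_fun_Suc step_fun_left)
  ultimately obtain u' w' where sys': "rotated_system z (step_fun a l q (Suc n)) (insert (a + l) ?S) a u' w'"
    and ini': "(u' a, w' a) = block_transfer z (a + l - a) (q 0) (u (a + l), w (a + l))"
    and tail': "\<And>s. a + l \<le> s \<Longrightarrow> u' s = u s \<and> w' s = w s"
    using rotated_system_extend_left[of z "step_fun a l q (Suc n)" ?S "a + l" u w a "q 0"]
      \<open>0 < l\<close> Suc.prems(2)[of 0] by auto
  show ?case
  proof (rule Suc.prems(1))
    \<comment> \<open>The new exceptional point is the grid point of index 1, so inserting it does
      not enlarge the grid.\<close>
    have "a + l \<in> ?S" by (auto intro!: image_eqI[of _ _ 1])
    then show "rotated_system z (step_fun a l q (Suc n)) ?S a u' w'"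
      using sys' by (simp add: insert_absorb)
    show "(u' a, w' a) = blocks_transfer z l q (Suc n)"
      using ini' ini by simp
    fix s assume s: "a + real (Suc n) * l \<le> s"
    have eq: "a + real (Suc n) * l = a + l + real n * l" by (simp add: algebra_simps)
    have "0 \<le> real n * l" using \<open>0 < l\<close> by simp
    with s eq have "a + l \<le> s" by linarith
    then show "u' s = 0 \<and> w' s = exp (\<i> * z * of_real (s - (a + real (Suc n) * l)) / 2)"
      using tail'[of s] tail[of s] s unfolding eq by simp
  qed
qed

section \<open>Canonical solutions with piecewise continuous Hamiltonians\<close>

text \<open>Under the identification of the real plane with the complex numbers,
  \<open>Xmat c\<close> is the antilinear map sending \<open>v\<close> to \<open>c * cnj v\<close>.
  Its complexification therefore interchanges the coordinates \<open>y1 + i y2\<close> and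
  \<open>y1 - i y2\<close>, with factors \<open>c\<close> and \<open>cnj c\<close>.\<close>

lemma cmat_mat_Xmat_mult:
  fixes c :: complex and y :: "complex^2"
  defines "b \<equiv> cmat (Finite_Cartesian_Product.mat (1/2) + Xmat c) *v y"
  shows "ent b 1 + \<i> * ent b 2 = (ent y 1 + \<i> * ent y 2) / 2 + c * (ent y 1 - \<i> * ent y 2)"
    and "ent b 1 - \<i> * ent b 2 = (ent y 1 - \<i> * ent y 2) / 2 + cnj c * (ent y 1 + \<i> * ent y 2)"
proof -
  have b: "ent b 1 = (1/2 + Re c) * ent y 1 + Im c * ent y 2"
    "ent b 2 = Im c * ent y 1 + (1/2 - Re c) * ent y 2"
    by (simp_all add: b_def cmat_def Xmat_def matrix_vector_mult_def sum_2
        Finite_Cartesian_Product.mat_def)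
  have c: "c = Re c + \<i> * Im c" "cnj c = Re c - \<i> * Im c"
    by (simp_all add: complex_eq_iff)
  show "ent b 1 + \<i> * ent b 2 = (ent y 1 + \<i> * ent y 2) / 2 + c * (ent y 1 - \<i> * ent y 2)"
    \<comment> \<open>The first four occurrences of \<open>c\<close> sit inside \<open>Re\<close>
      and \<open>Im\<close>; only the fifth is to be split.\<close>
    unfolding b by (subst (5) c(1)) (simp add: field_simps)
  show "ent b 1 - \<i> * ent b 2 = (ent y 1 - \<i> * ent y 2) / 2 + cnj c * (ent y 1 + \<i> * ent y 2)"
    unfolding b c(2) by (simp add: field_simps)
qed

lemma Jmat_mult_eq_iff:
  "Jmat *v a = z *s b \<longleftrightarrow> ent a 1 = z * ent b 2 \<and> ent a 2 = - z * ent b 1"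
proof -
  have "Jmat *v a = z *s b \<longleftrightarrow> - ent a 2 = z * ent b 1 \<and> ent a 1 = z * ent b 2"
    by (simp add: Jmat_def Finite_Cartesian_Product.vec_eq_iff forall_2 matrix_vector_mult_def sum_2)
  then show ?thesis by (auto simp: minus_equation_iff[of _ "z * ent b 1"])
qed

section \<open>Regularity of solutions and the passage between the two coordinate systems\<close>

lemma bounded_linear_complex2:
  "bounded_linear (\<lambda>y :: complex^2. ent y 1 + c * ent y 2)"
  unfolding linear_conv_bounded_linear[symmetric]
  by (rule linearI) (simp_all add: algebra_simps)

lemma bounded_linear_vector2:
  "bounded_linear (\<lambda>c :: complex. vector [c * a, c * b] :: complex^2)"
  unfolding linear_conv_bounded_linear[symmetric]
  by (rule linearI) (simp_all add: algebra_simps Finite_Cartesian_Product.vec_eq_iff forall_2)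

lemma indefinite_integral_continuous_on_atLeast:
  fixes f f' :: "real \<Rightarrow> 'a::banach"
  assumes "\<And>b. a \<le> b \<Longrightarrow> f' integrable_on {a..b}"
    and "\<And>b. a \<le> b \<Longrightarrow> f b = f a + integral {a..b} f'"
  shows "continuous_on {a..} f"
proof -
  have "continuous (at x within {a..}) f" if "a \<le> x" for x
  proof -
    have "continuous_on {a..x+1} (\<lambda>x. f a + integral {a..x} f')"
      using assms(1)[of "x + 1"] that
      by (intro continuous_intros indefinite_integral_continuous_1) auto
    then have "continuous_on {a..x+1} f"
      by (rule continuous_on_eq) (simp add: assms(2)[symmetric])
    then have "continuous (at x within {a..x+1}) f"
      using that by (auto simp: continuous_on_eq_continuous_within)
    moreover have "at x within {a..x+1} = at x within {a..}"
      by (rule at_within_nhd[of _ "{..<x+1}"]) auto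
    ultimately show ?thesis by simp
  qed
  then show ?thesis by (auto simp: continuous_on_eq_continuous_within)
qed

text \<open>The integral does not see the null set \<open>T\<close>, so \<open>f\<close> is also an
  indefinite integral of \<open>g\<close> and is differentiable wherever \<open>g\<close> is
  continuous. This turns an almost-everywhere equation into a classical one.\<close>

lemma indefinite_integral_derivative_AE:
  fixes f f' g :: "real \<Rightarrow> 'a::banach"
  assumes int: "\<And>b. a \<le> b \<Longrightarrow> f' integrable_on {a..b}"
    and f: "\<And>b. a \<le> b \<Longrightarrow> f b = f a + integral {a..b} f'"
    and "negligible T" and g: "\<And>s. a \<le> s \<Longrightarrow> s \<notin> T \<Longrightarrow> f' s = g s"
    and "a < s" and "isCont g s"
  shows "(f has_vector_derivative g s) (at s)"
proof -
  have eq: "integral {a..b} f' = integral {a..b} g" for b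
    by (rule integral_spike[OF \<open>negligible T\<close>]) (auto simp: g)
  have "g integrable_on {a..s+1}"
    using int[of "s+1"] \<open>a < s\<close> integrable_spike[OF _ \<open>negligible T\<close>, of f' "{a..s+1}" g] g by auto
  from integral_has_vector_derivative_continuous_at[OF this, of s "{}"]
  have "((\<lambda>u. integral {a..u} g) has_vector_derivative g s) (at s within {a..s+1})"
    using \<open>a < s\<close> \<open>isCont g s\<close> by (simp add: continuous_at_imp_continuous_at_within)
  then have "((\<lambda>u. f a + integral {a..u} g) has_vector_derivative g s) (at s within {a..s+1})"
    by (auto intro!: derivative_eq_intros)
  then have "((\<lambda>u. f a + integral {a..u} g) has_vector_derivative g s) (at s)"
    using \<open>a < s\<close> by (simp add: at_within_Icc_at)
  then show ?thesis
  proof (rule has_vector_derivative_transform_within_open[of _ _ _ "{a<..}"])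
    show "f a + integral {a..b} g = f b" if "b \<in> {a<..}" for b
      using f[of b] eq[of b] that by simp
  qed (use \<open>a < s\<close> in auto)
qed

text \<open>A bootstrap: \<open>Y\<close> is continuous as an indefinite integral, so the right-hand
  side of the system is continuous wherever \<open>p\<close> is, and there the equation holds
  classically.\<close>

lemma canonical_imp_rotated_system:
  assumes "canonical_solution z H Y"
    and H: "\<And>s. H s = Finite_Cartesian_Product.mat (1/2) + Xmat (p s)"
    and p: "\<And>s. s \<notin> S \<Longrightarrow> isCont p s"
  shows "rotated_system z p S 0
    (\<lambda>s. ent (Y s) 1 + \<i> * ent (Y s) 2) (\<lambda>s. ent (Y s) 1 - \<i> * ent (Y s) 2)"
proof -
  obtain Y' where Y': "\<And>s. 0 \<le> s \<Longrightarrow> Y' absolutely_integrable_on {0..s}"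
      "\<And>s. 0 \<le> s \<Longrightarrow> Y s = Y 0 + integral {0..s} Y'"
    and ae: "AE s in lebesgue_on {0..}. Jmat *v Y' s = z *s (cmat (H s) *v Y s)"
    using assms(1) by (auto simp: canonical_solution_def)
  obtain T where "negligible T"
    and T: "\<And>s. 0 \<le> s \<Longrightarrow> s \<notin> T \<Longrightarrow> Jmat *v Y' s = z *s (cmat (H s) *v Y s)"
  proof -
    have "AE s in lebesgue. 0 \<le> s \<longrightarrow> Jmat *v Y' s = z *s (cmat (H s) *v Y s)"
      using ae by (simp add: AE_restrict_space_iff)
    then obtain N where "N \<in> null_sets lebesgue"
      "{s \<in> space lebesgue. \<not> (0 \<le> s \<longrightarrow> Jmat *v Y' s = z *s (cmat (H s) *v Y s))} \<subseteq> N"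
      unfolding eventually_ae_filter by blast
    then show thesis
      by (intro that[of N]) (auto simp: negligible_iff_null_sets)
  qed
  \<comment> \<open>One functional serves both coordinates: the choice \<open>c = i\<close> gives
    \<open>u\<close>, and \<open>c = -i\<close> gives \<open>w\<close>.\<close>
  have lin: "((\<lambda>s. ent (Y' s) 1 + c * ent (Y' s) 2) integrable_on {0..s})"
    "ent (Y s) 1 + c * ent (Y s) 2 =
      ent (Y 0) 1 + c * ent (Y 0) 2 + integral {0..s} (\<lambda>s. ent (Y' s) 1 + c * ent (Y' s) 2)"
    if "0 \<le> s" for s c
  proof -
    have i: "Y' integrable_on {0..s}"
      using Y'(1)[OF that] set_lebesgue_integral_eq_integral(1) by blast
    show "((\<lambda>s. ent (Y' s) 1 + c * ent (Y' s) 2) integrable_on {0..s})"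
      using integrable_linear[OF i bounded_linear_complex2[of c]] by (simp add: o_def)
    have "integral {0..s} (\<lambda>s. ent (Y' s) 1 + c * ent (Y' s) 2)
        = ent (integral {0..s} Y') 1 + c * ent (integral {0..s} Y') 2"
      using integral_linear[OF i bounded_linear_complex2[of c]] by (simp add: o_def)
    then show "ent (Y s) 1 + c * ent (Y s) 2 =
      ent (Y 0) 1 + c * ent (Y 0) 2 + integral {0..s} (\<lambda>s. ent (Y' s) 1 + c * ent (Y' s) 2)"
      by (subst (1 2) Y'(2)[OF that]) (simp add: algebra_simps)
  qed
  define u w where "u = (\<lambda>s. ent (Y s) 1 + \<i> * ent (Y s) 2)" and "w = (\<lambda>s. ent (Y s) 1 - \<i> * ent (Y s) 2)"
  have u: "(\<lambda>s. ent (Y' s) 1 + \<i> * ent (Y' s) 2) integrable_on {0..s}"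
      "u s = u 0 + integral {0..s} (\<lambda>s. ent (Y' s) 1 + \<i> * ent (Y' s) 2)"
    and w: "(\<lambda>s. ent (Y' s) 1 - \<i> * ent (Y' s) 2) integrable_on {0..s}"
      "w s = w 0 + integral {0..s} (\<lambda>s. ent (Y' s) 1 - \<i> * ent (Y' s) 2)"
    if "0 \<le> s" for s
    using lin[OF that, of "\<i>"] lin[OF that, of "- \<i>"] by (simp_all add: u_def w_def)
  have cont: "continuous_on {0..} u" "continuous_on {0..} w"
    using indefinite_integral_continuous_on_atLeast[OF u]
      indefinite_integral_continuous_on_atLeast[OF w] by blast+
  have eqs: "ent (Y' s) 1 + \<i> * ent (Y' s) 2 = - (\<i> * z * (u s / 2 + p s * w s))"
     "ent (Y' s) 1 - \<i> * ent (Y' s) 2 = \<i> * z * (w s / 2 + cnj (p s) * u s)"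
    if "0 \<le> s" "s \<notin> T" for s
  proof -
    define b where "b = cmat (H s) *v Y s"
    have "ent (Y' s) 1 = z * ent b 2" "ent (Y' s) 2 = - z * ent b 1"
      using T[OF that] by (simp_all add: Jmat_mult_eq_iff b_def)
    then have "ent (Y' s) 1 + \<i> * ent (Y' s) 2 = - (\<i> * z * (ent b 1 + \<i> * ent b 2))"
       "ent (Y' s) 1 - \<i> * ent (Y' s) 2 = \<i> * z * (ent b 1 - \<i> * ent b 2)"
      by (simp_all add: algebra_simps)
    then show "ent (Y' s) 1 + \<i> * ent (Y' s) 2 = - (\<i> * z * (u s / 2 + p s * w s))"
     "ent (Y' s) 1 - \<i> * ent (Y' s) 2 = \<i> * z * (w s / 2 + cnj (p s) * u s)"
      unfolding b_def H cmat_mat_Xmat_mult u_def w_def by simp_all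
  qed
  have "(u has_vector_derivative - (\<i> * z * (u s / 2 + p s * w s))) (at s) \<and>
      (w has_vector_derivative \<i> * z * (w s / 2 + cnj (p s) * u s)) (at s)"
    if "0 < s" "s \<notin> S" for s
  proof
    have c: "isCont u s" "isCont w s"
      using cont \<open>0 < s\<close> by (auto intro: continuous_on_interior)
    note d = indefinite_integral_derivative_AE[where a = 0 and T = T]
    show "(u has_vector_derivative - (\<i> * z * (u s / 2 + p s * w s))) (at s)"
      by (rule d[OF u \<open>negligible T\<close> eqs(1) \<open>0 < s\<close>])
        (use c p[OF \<open>s \<notin> S\<close>] in \<open>auto intro!: continuous_intros\<close>)
    show "(w has_vector_derivative \<i> * z * (w s / 2 + cnj (p s) * u s)) (at s)"
      by (rule d[OF w \<open>negligible T\<close> eqs(2) \<open>0 < s\<close>])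
        (use c p[OF \<open>s \<notin> S\<close>] in \<open>auto intro!: continuous_intros\<close>)
  qed
  with cont show ?thesis by (auto simp: rotated_system_def u_def w_def)
qed

lemma absolutely_integrable_bounded_mult_continuous:
  fixes p f :: "real \<Rightarrow> complex"
  assumes "p \<in> borel_measurable borel" "bounded (range p)" "continuous_on {a..b} f"
  shows "(\<lambda>s. p s * f s) absolutely_integrable_on {a..b}"
proof (rule absolutely_integrable_bounded_measurable_product[where h = "(*)"])
  show "bilinear ((*) :: complex \<Rightarrow> _)" by (rule bilinear_times)
  show "p \<in> borel_measurable (lebesgue_on {a..b})"
    using assms(1) by (simp add: measurable_completion measurable_restrict_space1)
  show "bounded (p ` {a..b})" by (rule bounded_subset[OF assms(2)]) auto
  show "f absolutely_integrable_on {a..b}"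
    using assms(3) by (rule absolutely_integrable_continuous_real)
qed simp

text \<open>The fundamental theorem of calculus with finitely many exceptional points recovers
  \<open>u\<close> and \<open>w\<close> as integrals of their right-hand sides; a linear change of
  coordinates carries this over to \<open>Y\<close>.\<close>

lemma rotated_imp_canonical_solution:
  assumes sys: "rotated_system z p S 0 u w" and "finite S"
    and H: "\<And>s. H s = Finite_Cartesian_Product.mat (1/2) + Xmat (p s)"
    and p: "p \<in> borel_measurable borel" "bounded (range p)"
  shows "canonical_solution z H (\<lambda>s. vector [(u s + w s) / 2, (u s - w s) / (2 * \<i>)])"
proof -
  define u' w' where "u' = (\<lambda>s. - (\<i> * z * (u s / 2 + p s * w s)))"
    and "w' = (\<lambda>s. \<i> * z * (w s / 2 + cnj (p s) * u s))"
  \<comment> \<open>The two columns of the inverse coordinate change \<open>y1 = (u + w)/2\<close>,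
    \<open>y2 = (u - w)/(2i)\<close>.\<close>
  define L1 L2 :: "complex \<Rightarrow> complex^2"
    where "L1 = (\<lambda>c. vector [c * (1/2), c * (1 / (2 * \<i>))])"
      and "L2 = (\<lambda>c. vector [c * (1/2), c * - (1 / (2 * \<i>))])"
  have L: "bounded_linear L1" "bounded_linear L2"
    unfolding L1_def L2_def by (rule bounded_linear_vector2)+
  define Y where "Y = (\<lambda>s. vector [(u s + w s) / 2, (u s - w s) / (2 * \<i>)] :: complex^2)"
  have Y: "Y s = L1 (u s) + L2 (w s)" for s
    by (simp add: Y_def L1_def L2_def Finite_Cartesian_Product.vec_eq_iff forall_2 field_simps)
  have cont: "continuous_on {0..s} u" "continuous_on {0..s} w" for s
    using sys by (auto simp: rotated_system_def elim: continuous_on_subset)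
  have cp: "(\<lambda>s. cnj (p s)) \<in> borel_measurable borel" "bounded (range (\<lambda>s. cnj (p s)))"
    using p by (auto simp: bounded_iff intro!: borel_measurable_continuous_on[of cnj] continuous_intros)
  have ai: "u' absolutely_integrable_on {0..s}" "w' absolutely_integrable_on {0..s}" for s
  proof -
    have "(\<lambda>s. - (\<i> * z / 2 * u s) + p s * (- \<i> * z * w s)) absolutely_integrable_on {0..s}"
      by (intro set_integral_add(1) absolutely_integrable_continuous_real continuous_intros cont
          absolutely_integrable_bounded_mult_continuous p)
    then show "u' absolutely_integrable_on {0..s}" by (simp add: u'_def algebra_simps)
    have "(\<lambda>s. \<i> * z / 2 * w s + cnj (p s) * (\<i> * z * u s)) absolutely_integrable_on {0..s}"
      by (intro set_integral_add(1) absolutely_integrable_continuous_real continuous_intros cont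
          absolutely_integrable_bounded_mult_continuous cp)
    then show "w' absolutely_integrable_on {0..s}" by (simp add: w'_def algebra_simps)
  qed
  have hi: "(u' has_integral u s - u 0) {0..s}" "(w' has_integral w s - w 0) {0..s}" if "0 \<le> s" for s
    using sys unfolding u'_def w'_def
    by (auto intro!: fundamental_theorem_of_calculus_interior_strong[OF \<open>finite S\<close> that] cont
        simp: rotated_system_def)
  have "canonical_solution z H Y"
    unfolding canonical_solution_def
  proof (intro exI conjI allI impI)
    fix s :: real assume "0 \<le> s"
    show "(\<lambda>s. L1 (u' s) + L2 (w' s)) absolutely_integrable_on {0..s}"
      using absolutely_integrable_linear[OF ai(1) L(1)] absolutely_integrable_linear[OF ai(2) L(2)]
      by (intro set_integral_add(1)) (simp_all add: o_def)
    have "((\<lambda>s. L1 (u' s) + L2 (w' s)) has_integral L1 (u s - u 0) + L2 (w s - w 0)) {0..s}"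
      using has_integral_linear[OF hi(1)[OF \<open>0 \<le> s\<close>] L(1)] has_integral_linear[OF hi(2)[OF \<open>0 \<le> s\<close>] L(2)]
      by (intro has_integral_add) (simp_all add: o_def)
    then show "Y s = Y 0 + integral {0..s} (\<lambda>s. L1 (u' s) + L2 (w' s))"
      by (simp add: Y integral_unique linear_diff[OF bounded_linear.linear[OF L(1)]]
          linear_diff[OF bounded_linear.linear[OF L(2)]])
  next
    \<comment> \<open>Since \<open>u'\<close> and \<open>w'\<close> are defined as the right-hand
      sides of the rotated system, the equation holds at every point, including the jumps.\<close>
    have "Jmat *v (L1 (u' s) + L2 (w' s)) = z *s (cmat (H s) *v Y s)" for s
    proof -
      define b where "b = cmat (H s) *v Y s"
      have b: "ent b 1 + \<i> * ent b 2 = u s / 2 + p s * w s"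
        "ent b 1 - \<i> * ent b 2 = w s / 2 + cnj (p s) * u s"
        unfolding b_def H cmat_mat_Xmat_mult by (simp_all add: Y_def field_simps)
      have "u' s = - (\<i> * z * (ent b 1 + \<i> * ent b 2))" "w' s = \<i> * z * (ent b 1 - \<i> * ent b 2)"
        unfolding b by (simp_all add: u'_def w'_def)
      then show ?thesis
        by (simp add: Jmat_mult_eq_iff b_def[symmetric] L1_def L2_def field_simps)
    qed
    then show "AE s in lebesgue_on {0..}. Jmat *v (L1 (u' s) + L2 (w' s)) = z *s (cmat (H s) *v Y s)"
      by simp
  qed
  then show ?thesis by (simp add: Y_def)
qed

text \<open>The change to \<open>u\<close>, \<open>w\<close> is the square root of 2 times a unitary
  map, so the Hermitian pairing of \<open>Y\<close> with \<open>H Y\<close> is half the pairing in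
  the new coordinates.\<close>

lemma energy_density_rotated:
  assumes "H s = Finite_Cartesian_Product.mat (1/2) + Xmat c"
    and u: "u = ent (Y s) 1 + \<i> * ent (Y s) 2" and w: "w = ent (Y s) 1 - \<i> * ent (Y s) 2"
  shows "energy_density H Y s = (cnj u * (u / 2 + c * w) + cnj w * (w / 2 + cnj c * u)) / 2"
proof -
  define b where "b = cmat (H s) *v Y s"
  have b: "ent b 1 + \<i> * ent b 2 = u / 2 + c * w" "ent b 1 - \<i> * ent b 2 = w / 2 + cnj c * u"
    unfolding b_def assms(1) cmat_mat_Xmat_mult u w by simp_all
  show ?thesis
    unfolding b[symmetric] by (simp add: energy_density_def b_def[symmetric] sum_2 u w field_simps)
qed

section \<open>The Weyl coefficient\<close>

lemma not_integrable_bounded_below_at_top: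
  fixes e :: "real \<Rightarrow> complex"
  assumes "e absolutely_integrable_on {a..}" and "0 < k"
    and ge: "\<And>s. a \<le> s \<Longrightarrow> k \<le> cmod (e s)"
  shows False
proof -
  have int: "(\<lambda>s. cmod (e s)) integrable_on {a..}"
    using assms(1) by (simp add: absolutely_integrable_on_def)
  obtain n :: nat where n: "integral {a..} (\<lambda>s. cmod (e s)) < real n * k"
    using reals_Archimedean3[OF \<open>0 < k\<close>] by blast
  have sub: "(\<lambda>s. cmod (e s)) integrable_on {a..a + real n}"
    by (rule integrable_on_subinterval[OF int]) auto
  have "real n * k = integral {a..a + real n} (\<lambda>_. k)" by simp
  also have "\<dots> \<le> integral {a..a + real n} (\<lambda>s. cmod (e s))"
    by (rule integral_le[OF _ sub]) (auto simp: ge)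
  also have "\<dots> \<le> integral {a..} (\<lambda>s. cmod (e s))"
    by (rule integral_subset_le[OF _ sub int]) auto
  finally show False using n by simp
qed

lemma exp_decay_absolutely_integrable:
  assumes "0 < \<eta>"
  shows "(\<lambda>s. of_real (exp (- \<eta> * (s - a))) :: complex) absolutely_integrable_on {a..}"
proof -
  have "(\<lambda>s. exp (\<eta> * a) * exp (- \<eta> * s)) integrable_on {a..}"
    by (rule has_integral_integrable[OF has_integral_mult_right[OF
          has_integral_exp_minus_to_infinity[OF assms]]])
  then have "(\<lambda>s. exp (- \<eta> * (s - a))) integrable_on {a..}"
    by (simp add: algebra_simps flip: exp_add)
  then have "(\<lambda>s. exp (- \<eta> * (s - a))) absolutely_integrable_on {a..}"
    by (rule nonnegative_absolutely_integrable_1) simp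
  from absolutely_integrable_linear[OF this bounded_linear_of_real]
  show ?thesis by (simp add: o_def)
qed

lemma cnj_exp_mult_exp:
  "cnj (exp (\<i> * z * of_real t / 2)) * exp (\<i> * z * of_real t / 2) = of_real (exp (- Im z * t))"
proof -
  have "cnj (\<i> * z * of_real t / 2) + \<i> * z * of_real t / 2 = of_real (- Im z * t)"
    by (simp add: complex_eq_iff)
  then show ?thesis by (simp only: exp_cnj exp_of_real flip: exp_add)
qed

text \<open>The description by \<open>THE\<close> requires two things: the given solution, rescaled,
  has finite energy and initial slope \<open>?m\<close>; and any finite-energy competitor has
  Wronskian 0 with it, hence proportional data at 0.\<close>

lemma weyl_eq:
  assumes "0 \<le> \<Lambda>" "0 < Im z" "finite S"
    and sys: "rotated_system z p S 0 u w"
    and tail: "\<And>s. \<Lambda> \<le> s \<Longrightarrow> u s = 0 \<and> w s = exp (\<i> * z * of_real (s - \<Lambda>) / 2)"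
    and p: "p \<in> borel_measurable borel" "bounded (range p)" "\<And>s. s \<notin> S \<Longrightarrow> isCont p s"
    and p0: "\<And>s. \<Lambda> \<le> s \<Longrightarrow> p s = 0"
    and H: "\<And>s. extend_free \<Lambda> H s = Finite_Cartesian_Product.mat (1/2) + Xmat (p s)"
    and nz: "u 0 + w 0 \<noteq> 0"
  shows "weyl \<Lambda> H z = \<i> * (w 0 - u 0) / (w 0 + u 0)"
  unfolding weyl_def
proof (rule the_equality)
  let ?m = "\<i> * (w 0 - u 0) / (w 0 + u 0)"
  \<comment> \<open>The first component of \<open>Y\<close> at 0 is half the sum of the rotated
    coordinates; this factor normalizes it to 1.\<close>
  define c where "c = 2 / (u 0 + w 0)"
  define U W where "U = (\<lambda>s. c * u s)" and "W = (\<lambda>s. c * w s)"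
  have UW: "rotated_system z p S 0 U W"
    unfolding U_def W_def by (rule rotated_system_scale[OF sys])
  define Y :: "real \<Rightarrow> complex^2" where "Y = (\<lambda>s. vector [(U s + W s) / 2, (U s - W s) / (2 * \<i>)])"
  have "canonical_solution z (extend_free \<Lambda> H) Y"
    unfolding Y_def by (rule rotated_imp_canonical_solution[OF UW \<open>finite S\<close> H p(1,2)])
  moreover have "Y 0 = vector [1, ?m]"
  proof -
    define D where "D = w 0 + u 0"
    then have "D \<noteq> 0" "c = 2 / D" and u: "u 0 = D - w 0"
      using nz by (simp_all add: c_def add.commute)
    then show ?thesis
      unfolding D_def[symmetric] Y_def U_def W_def u
      by (simp add: Finite_Cartesian_Product.vec_eq_iff forall_2 field_simps)
  qed
  moreover have "energy_density (extend_free \<Lambda> H) Y absolutely_integrable_on {0..}"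
  proof -
    define e where "e = (\<lambda>s. (cnj (U s) * (U s / 2 + p s * W s) + cnj (W s) * (W s / 2 + cnj (p s) * U s)) / 2)"
    have "energy_density (extend_free \<Lambda> H) Y s = e s" for s
      unfolding e_def by (rule energy_density_rotated[where H = "extend_free \<Lambda> H" and s = s, OF H]) (simp_all add: Y_def field_simps)
    then have e: "energy_density (extend_free \<Lambda> H) Y = e" by auto
    have cont: "continuous_on {0..\<Lambda>} U" "continuous_on {0..\<Lambda>} W"
      using UW by (auto simp: rotated_system_def elim: continuous_on_subset)
    have cp: "(\<lambda>s. cnj (p s)) \<in> borel_measurable borel" "bounded (range (\<lambda>s. cnj (p s)))"
      using p by (auto simp: bounded_iff intro!: borel_measurable_continuous_on[of cnj] continuous_intros)
    \<comment> \<open>The energy is split into a continuous part and terms in which the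
      discontinuous \<open>p\<close> multiplies a continuous function.\<close>
    have "(\<lambda>s. (cnj (U s) * U s + cnj (W s) * W s) / 4 + (p s * (cnj (U s) * W s / 2) + cnj (p s) * (cnj (W s) * U s / 2)))
        absolutely_integrable_on {0..\<Lambda>}"
      by (intro set_integral_add(1) absolutely_integrable_continuous_real continuous_intros cont
          absolutely_integrable_bounded_mult_continuous cp p) auto
    also have "(\<lambda>s. (cnj (U s) * U s + cnj (W s) * W s) / 4 +
        (p s * (cnj (U s) * W s / 2) + cnj (p s) * (cnj (W s) * U s / 2))) = e"
      by (simp add: e_def fun_eq_iff field_simps)
    finally have 1: "e absolutely_integrable_on {0..\<Lambda>}" .
    \<comment> \<open>On the tail \<open>U = 0\<close>, which leaves the energy
      \<open>|W|^2/4\<close> with \<open>|W|^2 = |c|^2 exp(- Im z (s - \<Lambda>))\<close>,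
      integrable because \<open>Im z > 0\<close>.\<close>
    have int: "(\<lambda>s. cnj c * c / 4 * of_real (exp (- Im z * (s - \<Lambda>)))) absolutely_integrable_on {\<Lambda>..}"
      using exp_decay_absolutely_integrable[OF \<open>0 < Im z\<close>, of \<Lambda>]
      by (intro set_integrable_mult_right)
    have tail_eq: "cnj c * c / 4 * of_real (exp (- Im z * (s - \<Lambda>))) = e s" if "s \<in> {\<Lambda>..}" for s
    proof -
      have "U s = 0" "W s = c * exp (\<i> * z * of_real (s - \<Lambda>) / 2)"
        using tail[of s] that by (simp_all add: U_def W_def)
      then have "e s = cnj c * c / 4 * (cnj (exp (\<i> * z * of_real (s - \<Lambda>) / 2)) * exp (\<i> * z * of_real (s - \<Lambda>) / 2))"
        by (simp add: e_def)
      then show ?thesis unfolding cnj_exp_mult_exp by simp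
    qed
    have 2: "e absolutely_integrable_on {\<Lambda>..}"
      by (rule iffD1[OF set_integrable_cong[OF refl refl tail_eq] int])
    have "{0..} = {0..\<Lambda>} \<union> {\<Lambda>..}" using \<open>0 \<le> \<Lambda>\<close> by auto
    then show ?thesis unfolding e using absolutely_integrable_Un[OF 1 2] by simp
  qed
  ultimately show "\<exists>Y. canonical_solution z (extend_free \<Lambda> H) Y \<and> Y 0 = vector [1, ?m] \<and>
    energy_density (extend_free \<Lambda> H) Y absolutely_integrable_on {0..}" by blast
next
  fix m assume "\<exists>Y. canonical_solution z (extend_free \<Lambda> H) Y \<and> Y 0 = vector [1, m] \<and>
    energy_density (extend_free \<Lambda> H) Y absolutely_integrable_on {0..}"
  then obtain Y where Y: "canonical_solution z (extend_free \<Lambda> H) Y" "Y 0 = vector [1, m]"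
    and energy: "energy_density (extend_free \<Lambda> H) Y absolutely_integrable_on {0..}" by blast
  define U W where "U = (\<lambda>s. ent (Y s) 1 + \<i> * ent (Y s) 2)" and "W = (\<lambda>s. ent (Y s) 1 - \<i> * ent (Y s) 2)"
  have UW: "rotated_system z p S 0 U W"
    unfolding U_def W_def by (rule canonical_imp_rotated_system[OF Y(1) H p(3)])
  \<comment> \<open>As \<open>u = 0\<close> on the tail, the constancy of the Wronskian \<open>c\<close> makes \<open>U\<close> a multiple of an
    exponential of modulus at least 1 there, so finite energy forces \<open>c = 0\<close>.\<close>
  define c where "c = U 0 * w 0 - W 0 * u 0"
  have wr: "U s * w s - W s * u s = c" if "0 \<le> s" for s
    unfolding c_def by (rule rotated_system_wronskian[OF UW sys \<open>finite S\<close> that])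
  have "c = 0"
  proof (rule ccontr)
    assume "c \<noteq> 0"
    have ge: "(cmod c)\<^sup>2 / 4 \<le> cmod (energy_density (extend_free \<Lambda> H) Y s)" if s: "\<Lambda> \<le> s" for s
    proof -
      define E where "E = exp (\<i> * z * of_real (s - \<Lambda>) / 2)"
      have "cmod E \<le> 1"
        using s \<open>0 < Im z\<close> by (simp add: E_def)
      have "U s * E = c" using wr[of s] tail[OF s] s \<open>0 \<le> \<Lambda>\<close> by (simp add: E_def)
      then have "cmod c = cmod (U s) * cmod E" by (auto simp: norm_mult)
      then have le: "cmod c \<le> cmod (U s)" using \<open>cmod E \<le> 1\<close> by (simp add: mult_left_le)
      have "energy_density (extend_free \<Lambda> H) Y s =
          (cnj (U s) * (U s / 2 + p s * W s) + cnj (W s) * (W s / 2 + cnj (p s) * U s)) / 2"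
        by (rule energy_density_rotated[where H = "extend_free \<Lambda> H" and s = s, OF H])
          (simp_all add: U_def W_def)
      also have "\<dots> = (cnj (U s) * U s + cnj (W s) * W s) / 4"
        by (simp add: p0[OF s] field_simps)
      also have "\<dots> = of_real (((cmod (U s))\<^sup>2 + (cmod (W s))\<^sup>2) / 4)"
        by (simp add: complex_norm_square mult.commute del: of_real_power)
      finally have "cmod (energy_density (extend_free \<Lambda> H) Y s) = ((cmod (U s))\<^sup>2 + (cmod (W s))\<^sup>2) / 4"
        by (simp only: norm_of_real) simp
      then show ?thesis
        using power_mono[OF le norm_ge_zero, of 2] by (simp add: divide_right_mono add_increasing2)
    qed
    have "energy_density (extend_free \<Lambda> H) Y absolutely_integrable_on {\<Lambda>..}"
      by (rule set_integrable_subset[OF energy]) (use \<open>0 \<le> \<Lambda>\<close> in auto)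
    then show False
      by (rule not_integrable_bounded_below_at_top[OF _ _ ge]) (use \<open>c \<noteq> 0\<close> in auto)
  qed
  \<comment> \<open>The initial value \<open>(1, m)\<close> has rotated coordinates
    \<open>1 + i m\<close> and \<open>1 - i m\<close>, so the vanishing Wronskian is a linear
    equation for \<open>m\<close>.\<close>
  then have "(1 + \<i> * m) * w 0 = (1 - \<i> * m) * u 0"
    by (simp add: c_def U_def W_def Y(2))
  then have m: "\<i> * m * (w 0 + u 0) = u 0 - w 0" by (simp add: algebra_simps)
  have "m * (w 0 + u 0) = - \<i> * (\<i> * m * (w 0 + u 0))" by (simp add: mult.assoc)
  also have "\<dots> = \<i> * (w 0 - u 0)" unfolding m by (simp add: algebra_simps)
  finally show "m = \<i> * (w 0 - u 0) / (w 0 + u 0)"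
    using nz by (simp add: eq_divide_eq add.commute)
qed

lemma schur_eq:
  assumes "weyl \<Lambda> H z = \<i> * (w - u) / (w + u)" "w \<noteq> 0" "w + u \<noteq> 0"
  shows "schur \<Lambda> H z = - u / w"
proof -
  have "weyl \<Lambda> H z - \<i> = - 2 * \<i> * u / (w + u)" "weyl \<Lambda> H z + \<i> = 2 * \<i> * w / (w + u)"
    using assms by (simp_all add: field_simps)
  then show ?thesis using assms by (simp add: schur_def)
qed

section \<open>The Schur transform for step perturbations of the free Hamiltonian\<close>

lemma block_fun_step_fun: "block_fun l dq = step_fun 0 l (($) dq) (dim_vec dq)"
  by (auto simp: block_fun_def step_fun_def)

lemma step_fun_mult: "c * step_fun a l q n s = step_fun a l (\<lambda>j. c * q j) n s"
  by (simp only: step_fun_def sum_distrib_left mult.assoc)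

lemma Xmat_of_real_mult: "Xmat (of_real \<tau> * c) = \<tau> *\<^sub>R Xmat c"
  by (simp add: Xmat_def Finite_Cartesian_Product.vec_eq_iff forall_2)

lemma Xmat_0 [simp]: "Xmat 0 = 0"
  by (simp add: Xmat_def Finite_Cartesian_Product.vec_eq_iff forall_2)

lemma step_fun_measurable: "step_fun a l q n \<in> borel_measurable borel"
  unfolding step_fun_def by measurable

lemma step_fun_bounded: "bounded (range (step_fun a l q n))"
proof -
  have "cmod (step_fun a l q n s) \<le> (\<Sum>j<n. cmod (q j))" for s
    unfolding step_fun_def by (rule sum_norm_le) (simp add: norm_mult indicator_def)
  then show ?thesis by (auto simp: bounded_iff)
qed

lemma step_fun_isCont:
  assumes "s \<notin> (\<lambda>j. a + real j * l) ` {..n}"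
  shows "isCont (step_fun a l q n) s"
proof -
  have "isCont (\<lambda>s. indicator {a + real j * l..<a + real (j + 1) * l} s :: complex) s" if "j < n" for j
  proof -
    \<comment> \<open>Both endpoints of block \<open>j\<close> are grid points: \<open>j < n\<close>
      keeps the index \<open>Suc j\<close> within \<open>n\<close>.\<close>
    have "s \<noteq> a + real j * l" "s \<noteq> a + real (j + 1) * l"
      using assms that by (force simp: image_iff dest: bspec[of _ _ "Suc j"])+
    moreover have "closure {a + real j * l..<a + real (j + 1) * l} \<subseteq> {a + real j * l..a + real (j + 1) * l}"
      by (rule closure_minimal) auto
    ultimately have "isCont (indicator {a + real j * l..<a + real (j + 1) * l} :: real \<Rightarrow> real) s"
      unfolding isCont_indicator frontier_def by (auto simp: interior_atLeastLessThan)
    then have "isCont (\<lambda>s. complex_of_real (indicator {a + real j * l..<a + real (j + 1) * l} s)) s"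
      by (intro continuous_intros)
    then show ?thesis by (simp add: of_real_indicator)
  qed
  then show ?thesis unfolding step_fun_def by (intro continuous_intros) auto
qed

lemma schur_perturb_free:
  assumes "0 < l" "0 < Im z" and q: "\<And>j. j < n \<Longrightarrow> cmod (of_real \<tau> * q j) < 1/2"
    and V: "(u0, w0) = blocks_transfer z l (\<lambda>j. of_real \<tau> * q j) n" and nz: "w0 \<noteq> 0" "w0 + u0 \<noteq> 0"
  shows "schur (real n * l) (perturb free_hamiltonian (step_fun 0 l q n) \<tau>) z = - u0 / w0"
proof -
  define p where "p = step_fun 0 l (\<lambda>j. of_real \<tau> * q j) n"
  define S where "S = (\<lambda>j. 0 + real j * l) ` {..n}"
  obtain u w where sys: "rotated_system z p S 0 u w"
    and ini: "(u 0, w 0) = blocks_transfer z l (\<lambda>j. of_real \<tau> * q j) n"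
    and tail: "\<And>s. 0 + real n * l \<le> s \<Longrightarrow> u s = 0 \<and> w s = exp (\<i> * z * of_real (s - (0 + real n * l)) / 2)"
    using rotated_weyl_solution_exists[OF \<open>0 < l\<close>, of n "\<lambda>j. of_real \<tau> * q j"] q unfolding p_def S_def by blast
  have 0: "u 0 = u0" "w 0 = w0" using ini V by (metis prod.inject)+
  have "weyl (real n * l) (perturb free_hamiltonian (step_fun 0 l q n) \<tau>) z = \<i> * (w 0 - u 0) / (w 0 + u 0)"
  proof (rule weyl_eq[OF _ \<open>0 < Im z\<close> _ sys])
    show "p \<in> borel_measurable borel" "bounded (range p)"
      unfolding p_def by (rule step_fun_measurable step_fun_bounded)+
    show "isCont p s" if "s \<notin> S" for s
      using that unfolding S_def p_def by (rule step_fun_isCont)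
    show p0: "p s = 0" if "real n * l \<le> s" for s
      unfolding p_def using that \<open>0 < l\<close> by (simp add: step_fun_right)
    fix s
    have "p s = of_real \<tau> * step_fun 0 l q n s" unfolding p_def by (rule step_fun_mult[symmetric])
    then have "perturb free_hamiltonian (step_fun 0 l q n) \<tau> s = Finite_Cartesian_Product.mat (1/2) + Xmat (p s)"
      by (simp add: perturb_def free_hamiltonian_def Xmat_of_real_mult)
    \<comment> \<open>The step function vanishes from \<open>real n * l\<close> onwards, so the free
      extension changes nothing.\<close>
    then show "extend_free (real n * l) (perturb free_hamiltonian (step_fun 0 l q n) \<tau>) s
      = Finite_Cartesian_Product.mat (1/2) + Xmat (p s)"
      using p0[of s] by (simp add: extend_free_def free_hamiltonian_def)
  qed (use \<open>0 < l\<close> tail nz 0 in \<open>auto simp: S_def add.commute\<close>)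
  then show ?thesis unfolding 0 by (rule schur_eq[OF _ nz])
qed

section \<open>Differentiation at the free Hamiltonian\<close>

lemma has_vector_derivative_real_linear:
  "((\<lambda>t. of_real t * c) has_vector_derivative (c::complex)) (at t)"
  by (auto intro!: derivative_eq_intros)

text \<open>\<open>\<mu>\<close> depends on \<open>\<tau>\<close> only through its square, so
  \<open>\<mu>\<close>, \<open>C\<close> and \<open>\<sigma>\<close> all have derivative 0 at 0. The
  first-order change of \<open>u\<close> then consists of the freely propagated \<open>u'\<close>
  and the explicit coupling term in \<open>\<tau> * c * w\<close>; the coupling back into
  \<open>w\<close> is of second order because \<open>u\<close> vanishes at 0.\<close>

lemma block_transfer_perturbation:
  fixes z c :: complex and l :: real and u w :: "real \<Rightarrow> complex"
  defines "f \<equiv> \<lambda>\<tau>. block_transfer z l (of_real \<tau> * c) (u \<tau>, w \<tau>)"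
  assumes u: "(u has_vector_derivative u') (at 0)" "u 0 = 0" and w: "w differentiable (at 0)"
  shows "((\<lambda>\<tau>. fst (f \<tau>)) has_vector_derivative
      exp (\<i> * z * of_real l / 2) * u' + 2 * \<i> * sin (z * of_real l / 2) * c * w 0) (at 0)"
    and "(\<lambda>\<tau>. snd (f \<tau>)) differentiable (at 0)"
    and "fst (f 0) = 0"
    and "snd (f 0) = exp (- (\<i> * z * of_real l / 2)) * w 0"
proof -
  define \<mu> where "\<mu> = (\<lambda>\<tau>. complex_of_real (sqrt (1/4 - (cmod (of_real \<tau> * c))\<^sup>2)))"
  have \<mu>0: "\<mu> 0 = 1/2" by (simp add: \<mu>_def real_sqrt_divide)
  have "((\<lambda>\<tau>. sqrt (1/4 - (\<tau> * cmod c)\<^sup>2)) has_real_derivative 0) (at 0)"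
    by (auto intro!: derivative_eq_intros)
  then have "((\<lambda>\<tau>. complex_of_real (sqrt (1/4 - (\<tau> * cmod c)\<^sup>2))) has_vector_derivative of_real 0) (at 0)"
    by (intro has_vector_derivative_of_real) (simp add: has_real_derivative_iff_has_vector_derivative)
  then have d\<mu>: "(\<mu> has_vector_derivative 0) (at 0)"
    by (simp add: \<mu>_def norm_mult power_mult_distrib)
  define C \<sigma> where "C = (\<lambda>\<tau>. cos (z * \<mu> \<tau> * of_real l))"
    and "\<sigma> = (\<lambda>\<tau>. sin (z * \<mu> \<tau> * of_real l) / \<mu> \<tau>)"
  have "((\<lambda>\<zeta>. cos (z * \<zeta> * of_real l)) has_field_derivative - sin (z * \<mu> 0 * of_real l) * (z * of_real l)) (at (\<mu> 0))"
    by (auto intro!: derivative_eq_intros)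
  from field_vector_diff_chain_at[OF d\<mu> this] have dC: "(C has_vector_derivative 0) (at 0)"
    by (simp add: C_def o_def)
  have "((\<lambda>\<zeta>. sin (z * \<zeta> * of_real l) / \<zeta>) has_field_derivative
      (cos (z * \<mu> 0 * of_real l) * (z * of_real l) * \<mu> 0 - sin (z * \<mu> 0 * of_real l)) / (\<mu> 0 * \<mu> 0)) (at (\<mu> 0))"
    by (auto intro!: derivative_eq_intros simp: \<mu>0)
  from field_vector_diff_chain_at[OF d\<mu> this] have d\<sigma>: "(\<sigma> has_vector_derivative 0) (at 0)"
    by (simp add: \<sigma>_def o_def)
  have C0: "C 0 = cos (z * of_real l / 2)" and \<sigma>0: "\<sigma> 0 = 2 * sin (z * of_real l / 2)"
    by (simp_all add: C_def \<sigma>_def \<mu>0)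
  have E: "exp (\<i> * z * of_real l / 2) = C 0 + \<i> * \<sigma> 0 / 2"
    "exp (- (\<i> * z * of_real l / 2)) = C 0 - \<i> * \<sigma> 0 / 2"
    using exp_Euler[of "z * of_real l / 2"] exp_Euler[of "- (z * of_real l / 2)"]
    by (simp_all add: C0 \<sigma>0 mult.assoc)
  have f: "f = (\<lambda>\<tau>. ((C \<tau> + \<i> * \<sigma> \<tau> / 2) * u \<tau> + \<i> * \<sigma> \<tau> * (of_real \<tau> * c) * w \<tau>,
         (C \<tau> - \<i> * \<sigma> \<tau> / 2) * w \<tau> - \<i> * \<sigma> \<tau> * (of_real \<tau> * cnj c) * u \<tau>))"
    by (simp add: f_def block_transfer_def Let_def \<mu>_def C_def \<sigma>_def)
  obtain w' where w': "(w has_vector_derivative w') (at 0)"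
    using w by (auto simp: vector_derivative_works)
  show "((\<lambda>\<tau>. fst (f \<tau>)) has_vector_derivative
      exp (\<i> * z * of_real l / 2) * u' + 2 * \<i> * sin (z * of_real l / 2) * c * w 0) (at 0)"
    unfolding f fst_conv E
    by (rule derivative_eq_intros dC d\<sigma> u(1) w' has_vector_derivative_real_linear refl)+
      (simp add: u(2) \<sigma>0 algebra_simps)
  have "((\<lambda>\<tau>. snd (f \<tau>)) has_vector_derivative (C 0 - \<i> * \<sigma> 0 / 2) * w') (at 0)"
    unfolding f snd_conv
    by (rule derivative_eq_intros dC d\<sigma> u(1) w' has_vector_derivative_real_linear refl)+
      (simp add: u(2))
  then show "(\<lambda>\<tau>. snd (f \<tau>)) differentiable (at 0)"
    by (rule differentiableI_vector)
  show "fst (f 0) = 0" "snd (f 0) = exp (- (\<i> * z * of_real l / 2)) * w 0"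
    by (simp_all add: f E u(2))
qed

text \<open>Let \<open>r\<close> be the derivative of the first component divided by the second
  component at 0, and \<open>e = exp(izl/2)\<close>. A block turns \<open>r\<close> into
  \<open>e^2 r + 2i sin(zl/2) e q_0\<close>; unrolling this recursion yields the sum. Keeping
  \<open>snd (V q n 0)\<close> as a factor avoids the division.\<close>

lemma blocks_transfer_perturbation:
  fixes z :: complex and l :: real
  defines "V \<equiv> \<lambda>q n \<tau>. blocks_transfer z l (\<lambda>j. of_real \<tau> * q j) n"
  shows "((\<lambda>\<tau>. fst (V q n \<tau>)) has_vector_derivative
      snd (V q n 0) * (2 * \<i> * sin (z * of_real l / 2) *
        (\<Sum>j<n. q j * exp (\<i> * z * (of_nat j + 1/2) * of_real l)))) (at 0) \<and>
    (\<lambda>\<tau>. snd (V q n \<tau>)) differentiable (at 0) \<and> fst (V q n 0) = 0 \<and> snd (V q n 0) \<noteq> 0"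
proof (induction n arbitrary: q)
  case 0
  show ?case by (simp add: V_def)
next
  case (Suc n)
  let ?s = "sin (z * of_real l / 2)" and ?V = "V (q \<circ> Suc) n"
  let ?u' = "snd (?V 0) * (2 * \<i> * ?s * (\<Sum>j<n. (q \<circ> Suc) j * exp (\<i> * z * (of_nat j + 1/2) * of_real l)))"
  have V: "V q (Suc n) \<tau> = block_transfer z l (of_real \<tau> * q 0) (fst (?V \<tau>), snd (?V \<tau>))" for \<tau>
    by (simp add: V_def o_def)
  note IH = Suc.IH[of "q \<circ> Suc"]
  have ih: "((\<lambda>\<tau>. fst (?V \<tau>)) has_vector_derivative ?u') (at 0)" "fst (?V 0) = 0"
    "(\<lambda>\<tau>. snd (?V \<tau>)) differentiable (at 0)"
    using IH by blast+
  note step = block_transfer_perturbation[where l = l and z = z and c = "q 0", OF ih, folded V]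
  have E: "exp (\<i> * z * of_real l / 2) * exp (- (\<i> * z * of_real l / 2)) = 1"
    by (simp add: exp_minus)
  \<comment> \<open>Moving a block by one place costs a full block length, written as two
    half-length factors so that one of them matches the midpoint factor of block 0.\<close>
  have shift: "exp (\<i> * z * (of_nat (Suc j) + 1/2) * of_real l) =
      exp (\<i> * z * of_real l / 2) * exp (\<i> * z * of_real l / 2) * exp (\<i> * z * (of_nat j + 1/2) * of_real l)" for j
    by (simp add: algebra_simps flip: exp_add)
  have sum: "(\<Sum>j<Suc n. q j * exp (\<i> * z * (of_nat j + 1/2) * of_real l)) =
      exp (\<i> * z * of_real l / 2) * (q 0 + exp (\<i> * z * of_real l / 2) *
        (\<Sum>j<n. (q \<circ> Suc) j * exp (\<i> * z * (of_nat j + 1/2) * of_real l)))"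
    by (subst sum.lessThan_Suc_shift) (simp only: shift sum_distrib_left o_def, simp add: algebra_simps sum_distrib_left)
  have s: "snd (V q (Suc n) 0) = exp (- (\<i> * z * of_real l / 2)) * snd (?V 0)"
    by (rule step(4))
  have eq: "exp (\<i> * z * of_real l / 2) * ?u' + 2 * \<i> * ?s * q 0 * snd (?V 0) =
     snd (V q (Suc n) 0) * (2 * \<i> * ?s * (\<Sum>j<Suc n. q j * exp (\<i> * z * (of_nat j + 1/2) * of_real l)))"
  proof -
    define a b x y where "a = exp (\<i> * z * of_real l / 2)" and "b = exp (- (\<i> * z * of_real l / 2))"
      and "x = snd (?V 0)" and "y = (\<Sum>j<n. (q \<circ> Suc) j * exp (\<i> * z * (of_nat j + 1/2) * of_real l))"
    \<comment> \<open>Inserting \<open>a * b = 1\<close> extracts \<open>b * x\<close>, the new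
      second component at 0.\<close>
    have "a * (x * (2 * \<i> * ?s * y)) + 2 * \<i> * ?s * q 0 * x = (a * b) * (2 * \<i> * ?s * x * (q 0 + a * y))"
      using E by (simp add: a_def b_def algebra_simps)
    also have "\<dots> = b * x * (2 * \<i> * ?s * (a * (q 0 + a * y)))"
      by (simp add: algebra_simps)
    finally show ?thesis unfolding s sum a_def b_def x_def y_def .
  qed
  show ?case
  proof (intro conjI)
    have "snd (?V 0) \<noteq> 0" using IH by blast
    then show "snd (V q (Suc n) 0) \<noteq> 0" unfolding s by simp
  qed (rule step(1)[unfolded eq] step(2,3))+
qed

text \<open>As \<open>u\<close> vanishes at 0, the derivative of \<open>-u/w\<close> there is
  \<open>-u'(0)/w(0)\<close>, and the factor \<open>w 0\<close> contained in \<open>u'(0)\<close>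
  cancels.\<close>

lemma schur_free_derivative:
  fixes q :: "nat \<Rightarrow> complex" and n :: nat
  assumes "0 < l" "0 < Im z"
  defines "D \<equiv> - 2 * \<i> * sin (z * of_real l / 2) *
      (\<Sum>j<n. q j * exp (\<i> * z * (of_nat j + 1/2) * of_real l))"
  shows "((\<lambda>\<tau>. schur (real n * l) (perturb free_hamiltonian (step_fun 0 l q n) \<tau>) z)
    has_vector_derivative D) (at 0)"
proof -
  define u w where "u = (\<lambda>\<tau>. fst (blocks_transfer z l (\<lambda>j. of_real \<tau> * q j) n))"
    and "w = (\<lambda>\<tau>. snd (blocks_transfer z l (\<lambda>j. of_real \<tau> * q j) n))"
  have u: "(u has_vector_derivative w 0 * - D) (at 0)" and w: "w differentiable (at 0)"
    and 0: "u 0 = 0" "w 0 \<noteq> 0"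
    using blocks_transfer_perturbation[of z l q n]
    by (simp_all add: u_def w_def D_def algebra_simps)
  obtain w' where w': "(w has_vector_derivative w') (at 0)"
    using w by (auto simp: vector_derivative_works)
  have cont: "isCont u 0" "isCont w 0"
    using u w' by (auto intro: has_vector_derivative_continuous)
  have "((\<lambda>\<tau>. - u \<tau> / w \<tau>) has_vector_derivative D) (at 0)"
  proof -
    have "((\<lambda>\<tau>. inverse (w \<tau>)) has_vector_derivative - (inverse (w 0) * w' * inverse (w 0))) (at 0)"
      using Deriv.has_derivative_inverse[OF 0(2) w'[unfolded has_vector_derivative_def]]
      by (simp add: has_vector_derivative_def)
    from has_vector_derivative_mult[OF has_vector_derivative_minus[OF u] this]
    moreover have "w 0 * D * inverse (w 0) = D" using 0 by (simp add: field_simps)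
    ultimately show ?thesis using 0 by (simp add: divide_inverse)
  qed
  \<comment> \<open>The conditions on \<open>\<tau>\<close> in \<open>schur_perturb_free\<close> are
    open and hold at 0, where \<open>w + u\<close> equals \<open>w\<close>. The filter is
    \<open>nhds 0\<close> because the transfer of the derivative also needs equality at 0
    itself.\<close>
  moreover have "\<forall>\<^sub>F \<tau> in nhds 0. - u \<tau> / w \<tau> = schur (real n * l) (perturb free_hamiltonian (step_fun 0 l q n) \<tau>) z"
  proof -
    have lim: "(u \<longlongrightarrow> u 0) (nhds 0)" "(w \<longlongrightarrow> w 0) (nhds 0)"
      using cont by (simp_all add: continuous_at tendsto_at_iff_tendsto_nhds)
    have "\<forall>\<^sub>F \<tau> in nhds 0. w \<tau> \<noteq> 0"
      by (rule tendsto_imp_eventually_ne[OF lim(2) 0(2)])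
    moreover have "\<forall>\<^sub>F \<tau> in nhds 0. w \<tau> + u \<tau> \<noteq> 0"
      by (rule tendsto_imp_eventually_ne[OF tendsto_add[OF lim(2,1)]]) (simp add: 0)
    moreover have "\<forall>\<^sub>F \<tau> in nhds (0::real). \<forall>j\<in>{..<n}. cmod (of_real \<tau> * q j) < 1/2"
    proof (intro eventually_ball_finite ballI)
      fix j
      have "isCont (\<lambda>\<tau>::real. cmod (of_real \<tau> * q j)) 0"
        by (intro continuous_intros)
      then have "((\<lambda>\<tau>::real. cmod (of_real \<tau> * q j)) \<longlongrightarrow> cmod (of_real 0 * q j)) (nhds 0)"
        unfolding continuous_at by (subst (asm) tendsto_at_iff_tendsto_nhds)
      then show "\<forall>\<^sub>F \<tau> in nhds (0::real). cmod (of_real \<tau> * q j) < 1/2"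
        by (rule order_tendstoD(2)) simp
    qed simp
    ultimately show ?thesis
    proof eventually_elim
      case (elim \<tau>)
      then show ?case
        using schur_perturb_free[OF assms(1,2), of n \<tau> q "u \<tau>" "w \<tau>"] by (simp add: u_def w_def)
    qed
  qed
  ultimately show ?thesis
    by (subst has_vector_derivative_cong_ev[where g = "\<lambda>\<tau>. - u \<tau> / w \<tau>"])
      (auto elim: eventually_mono dest: eventually_nhds_x_imp_x)
qed

section \<open>Factorization of the free Jacobian\<close>

text \<open>Of the exponent at the block midpoint, the half-block phase in \<open>x\<close> goes
  into \<open>gam\<close>, the phase in \<open>x * j\<close> is the entry of \<open>Fmat\<close>,
  and the whole part in \<eta> becomes the real weight.\<close>

lemma exp_block_split:
  assumes "z = Complex x \<eta>"
  shows "- 2 * \<i> * sin (z * of_real l / 2) * exp (\<i> * z * (of_nat j + 1/2) * of_real l) =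
    gam \<eta> l x * (exp (\<i> * of_real x * of_nat j * of_real l) * of_real (wgt \<eta> l j))"
proof -
  have z: "z = of_real x + \<i> * of_real \<eta>"
    using assms by (simp add: complex_eq_iff)
  have "\<i> * z * (of_nat j + 1/2) * of_real l =
      \<i> * of_real x * of_real l / 2 + (\<i> * of_real x * of_nat j * of_real l + of_real (- \<eta> * (real j + 1/2) * l))"
    unfolding z by (simp add: field_simps)
  then show ?thesis
    unfolding gam_def wgt_def assms by (simp only: exp_add exp_of_real mult.assoc)
qed

lemma gam_Fmat_wgt_mult_vec:
  assumes "x \<in> carrier_vec M" "dq \<in> carrier_vec N" "k < M"
  shows "((Dgam \<eta> l x * Fmat l N x * Dwgt \<eta> l N) *\<^sub>v dq) $ k =
    gam \<eta> l (x $ k) * (\<Sum>j<N. dq $ j * exp (\<i> * of_real (x $ k) * of_nat j * of_real l) * of_real (wgt \<eta> l j))"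
proof -
  have F: "Fmat l N x \<in> carrier_mat M N"
    using assms by (simp add: Fmat_def)
  have "Dgam \<eta> l x * Fmat l N x = Matrix.mat M N (\<lambda>(i, j). gam \<eta> l (x $ i) * Fmat l N x $$ (i, j))"
    using mat_diag_mult_left[OF F] assms(1) by (simp add: Dgam_def)
  then have "Dgam \<eta> l x * Fmat l N x * Dwgt \<eta> l N =
      Matrix.mat M N (\<lambda>(i, j). gam \<eta> l (x $ i) * Fmat l N x $$ (i, j) * of_real (wgt \<eta> l j))"
    by (auto simp: Dwgt_def mat_diag_mult_right[of _ M N] intro!: eq_matI)
  then show ?thesis
    using assms
    by (auto simp: scalar_prod_def Fmat_def sum_distrib_left atLeast0LessThan intro!: sum.cong)
qed

theorem theorem5p1:
  fixes \<Lambda> \<eta> l :: real and N :: nat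
  assumes "\<Lambda> > 0" and "\<eta> > 0" and "N \<ge> 1" and "l = \<Lambda> / real N"
  shows
    "(\<forall>(x::real) (z::complex) (dq::complex vec).
        z = Complex x \<eta> \<longrightarrow> dq \<in> carrier_vec N \<longrightarrow>
        (\<lambda>\<tau>. schur \<Lambda> (perturb free_hamiltonian (block_fun l dq) \<tau>) z) differentiable (at 0) \<and>
        Dv \<Lambda> free_hamiltonian z (block_fun l dq) =
          - 2 * \<i> * sin (z * of_real l / 2) *
          (\<Sum>j<N. dq $ j * exp (\<i> * z * (of_nat j + 1/2) * of_real l))) \<and>
     (\<forall>(M::nat) (x::real vec) (dq::complex vec).
        x \<in> carrier_vec M \<longrightarrow> dq \<in> carrier_vec N \<longrightarrow>
        (\<forall>k<M. free_jacobian \<Lambda> \<eta> N x dq $ k =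
           gam \<eta> l (x $ k) *
           (\<Sum>j<N. dq $ j * exp (\<i> * of_real (x $ k) * of_nat j * of_real l) *
                    of_real (wgt \<eta> l j))) \<and>
        free_jacobian \<Lambda> \<eta> N x dq = (Dgam \<eta> l x * Fmat l N x * Dwgt \<eta> l N) *\<^sub>v dq)"
proof -
  have l: "0 < l" "real N * l = \<Lambda>" using assms by auto
  \<comment> \<open>\<open>Dv\<close> rests on a choice operator whose value is informative only for
    a differentiable path, so the stronger fact is proved first; it yields both differentiability
    and the formula.\<close>
  have der: "((\<lambda>\<tau>. schur \<Lambda> (perturb free_hamiltonian (block_fun l dq) \<tau>) z) has_vector_derivative
      - 2 * \<i> * sin (z * of_real l / 2) *
      (\<Sum>j<N. dq $ j * exp (\<i> * z * (of_nat j + 1/2) * of_real l))) (at 0)"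
    if "z = Complex x \<eta>" "dq \<in> carrier_vec N" for x z dq
    using schur_free_derivative[OF \<open>0 < l\<close>, where n = N and z = z and q = "($) dq"] that \<open>\<eta> > 0\<close>
    unfolding l(2) block_fun_step_fun by simp
  then have Dv: "Dv \<Lambda> free_hamiltonian z (block_fun l dq) =
      - 2 * \<i> * sin (z * of_real l / 2) *
      (\<Sum>j<N. dq $ j * exp (\<i> * z * (of_nat j + 1/2) * of_real l))"
    if "z = Complex x \<eta>" "dq \<in> carrier_vec N" for x z dq
    using that unfolding Dv_def by (blast intro: vector_derivative_at)
  have jac: "free_jacobian \<Lambda> \<eta> N x dq $ k =
      gam \<eta> l (x $ k) * (\<Sum>j<N. dq $ j * exp (\<i> * of_real (x $ k) * of_nat j * of_real l) * of_real (wgt \<eta> l j))"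
    if "x \<in> carrier_vec M" "dq \<in> carrier_vec N" "k < M" for M x dq k
  proof -
    have "free_jacobian \<Lambda> \<eta> N x dq $ k = Dv \<Lambda> free_hamiltonian (Complex (x $ k) \<eta>) (block_fun l dq)"
      using that assms(4) by (simp add: free_jacobian_def)
    \<comment> \<open>The sine factor is moved into the sum to form the product that
      \<open>exp_block_split\<close> rewrites; afterwards \<open>gam\<close> is taken out
      again.\<close>
    also have "\<dots> = (\<Sum>j<N. dq $ j * (- 2 * \<i> * sin (Complex (x $ k) \<eta> * of_real l / 2) *
        exp (\<i> * Complex (x $ k) \<eta> * (of_nat j + 1/2) * of_real l)))"
      unfolding Dv[OF refl that(2)] sum_distrib_left by (intro sum.cong refl) (simp only: mult_ac)
    also have "\<dots> = gam \<eta> l (x $ k) * (\<Sum>j<N. dq $ j * exp (\<i> * of_real (x $ k) * of_nat j * of_real l) * of_real (wgt \<eta> l j))"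
      unfolding exp_block_split[OF refl] sum_distrib_left by (intro sum.cong refl) (simp only: mult_ac)
    finally show ?thesis .
  qed
  show ?thesis
  proof (intro conjI allI impI)
    fix M :: nat and x :: "real vec" and dq :: "complex vec"
    assume x: "x \<in> carrier_vec M" and dq: "dq \<in> carrier_vec N"
    show "free_jacobian \<Lambda> \<eta> N x dq = (Dgam \<eta> l x * Fmat l N x * Dwgt \<eta> l N) *\<^sub>v dq"
    proof (rule eq_vecI)
      show "dim_vec (free_jacobian \<Lambda> \<eta> N x dq) = dim_vec ((Dgam \<eta> l x * Fmat l N x * Dwgt \<eta> l N) *\<^sub>v dq)"
        by (simp add: free_jacobian_def Dgam_def mat_diag_def)
      fix k assume "k < dim_vec ((Dgam \<eta> l x * Fmat l N x * Dwgt \<eta> l N) *\<^sub>v dq)"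
      then have "k < M" using x by (simp add: Dgam_def mat_diag_def)
      then show "free_jacobian \<Lambda> \<eta> N x dq $ k = ((Dgam \<eta> l x * Fmat l N x * Dwgt \<eta> l N) *\<^sub>v dq) $ k"
        using jac[OF x dq] gam_Fmat_wgt_mult_vec[OF x dq] by simp
    qed
  qed (use der Dv jac in \<open>blast intro: differentiableI_vector\<close>)+
qed

end
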